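(* Let $(X_n)_{n=1}^\infty$ be a sequence of completely regular spaces, let $P=\prod_{n=1}^\infty X_n$ (with the product topology), and let $X$ be a subspace of $P$. Assume that one of the following conditions holds: (1) $P$ is perfectly normal, or (2) $X$ is Lindelöf. Let $(Y,d)$ be a path-connected separable R-space. Then every Lebesgue one function $f:X\to Y$ is the pointwise limit on $X$ of a sequence of functions from ${\rm CF}(X,Y)$.
   Context: A map $f:X\to Y$ between topological spaces is a Lebesgue one function (belongs to the first Lebesgue class, $f\in {\rm H}_1(X,Y)$) if $f^{-1}(V)$ is an $F_\sigma$-set in $X$ for every open $V\subseteq Y$. For a subspace $X$ of a product $P=\prod_{n=1}^\infty X_n$, a map $f:X\to Y$ is finitely determined (depends on finitely many coordinates) if there is $n\in\mathbb N$ such that $f(x)=f(y)$ for all $x,y\in X$ with $x_i=y_i$ for $i=1,\dots,n$. ${\rm CF}(X,Y)$ denotes the set of all continuous finitely determined maps $X\to Y$. A metric space $(Y,d)$ is an R-space if for every $\varepsilon>0$ there exists a continuous map $r_\varepsilon:Y\times Y\to Y$ such that for all $y,z\in Y$: if $d(y,z)\le\varepsilon$ then $r_\varepsilon(y,z)=y$; and $d(r_\varepsilon(y,z),z)\le\varepsilon$. *)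

theory Defs
  imports "HOL-Analysis.Analysis"
begin

text \<open>No separation axiom beyond those spelled out is built into perfect normality here (nor into
  the library's \<^const>\<open>completely_regular_space\<close>, \<^const>\<open>normal_space\<close> and \<^const>\<open>Lindelof_space\<close>):
  in particular, spaces are not assumed to be T1.\<close>

definition perfectly_normal_space :: "'a topology \<Rightarrow> bool" where
  "perfectly_normal_space X \<longleftrightarrow>
     normal_space X \<and> (\<forall>S. closedin X S \<longrightarrow> gdelta_in X S)"

definition Lebesgue_one :: "'a topology \<Rightarrow> 'b topology \<Rightarrow> ('a \<Rightarrow> 'b) set" where
  "Lebesgue_one X Y =
     {f \<in> topspace X \<rightarrow> topspace Y. \<forall>V. openin Y V \<longrightarrow> fsigma_in X {x \<in> topspace X. f x \<in> V}}"

text \<open>Coordinates are numbered from 0, so the first \<open>n\<close> coordinates are those with index below \<open>n\<close>.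
  Allowing \<open>n = 0\<close> (constant maps) does not enlarge the class.\<close>

definition finitely_determined_on :: "(nat \<Rightarrow> 'a) set \<Rightarrow> ((nat \<Rightarrow> 'a) \<Rightarrow> 'b) \<Rightarrow> bool" where
  "finitely_determined_on S f \<longleftrightarrow>
     (\<exists>n. \<forall>x\<in>S. \<forall>y\<in>S. (\<forall>i<n. x i = y i) \<longrightarrow> f x = f y)"

definition CF :: "(nat \<Rightarrow> 'a) topology \<Rightarrow> 'b topology \<Rightarrow> ((nat \<Rightarrow> 'a) \<Rightarrow> 'b) set" where
  "CF X Y = {f. continuous_map X Y f \<and> finitely_determined_on (topspace X) f}"

definition R_space :: "'b metric \<Rightarrow> bool" where
  "R_space Y \<longleftrightarrow>
     (\<forall>\<epsilon>>0. \<exists>r. continuous_map (prod_topology (mtopology_of Y) (mtopology_of Y)) (mtopology_of Y) r \<and>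
        (\<forall>y\<in>mspace Y. \<forall>z\<in>mspace Y.
           (mdist Y y z \<le> \<epsilon> \<longrightarrow> r (y, z) = y) \<and> mdist Y (r (y, z)) z \<le> \<epsilon>))"

end

theory Submission
  imports Defs
begin

text \<open>Under either hypothesis on the spaces, every closed set can be separated from the complement
  of an open neighbourhood by a common zero set of countably many continuous finitely determined
  real functions. Hence, for a Lebesgue one map, the preimage of a ball is squeezed, up to passing
  to the closed ball, by a countable union of such zero sets. By separability, \<open>f\<close> is within
  \<open>\<epsilon>\<close> of a map that sends \<open>x\<close> to a point \<open>t j\<close>, with \<open>j\<close> the first index of a zero set containing \<open>x\<close>;
  path-connectedness makes this map a pointwise, eventually stationary limit of \<open>CF\<close> maps. The
  R-space retractions glue these approximations for \<open>\<epsilon> = 2^(-m)\<close> into one sequence.\<close>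

section \<open>Closure properties of continuous finitely determined maps\<close>

text \<open>Finitely many maps share a number of determining coordinates, namely a bound of their
  individual ones; whatever factors through these maps inherits it.\<close>

lemma finitely_determined_on_combine:
  assumes "finite G"
    and G: "\<And>g. g \<in> G \<Longrightarrow> finitely_determined_on S g"
    and h: "\<And>x y. x \<in> S \<Longrightarrow> y \<in> S \<Longrightarrow> (\<And>g. g \<in> G \<Longrightarrow> g x = g y) \<Longrightarrow> h x = h y"
  shows "finitely_determined_on S h"
proof -
  obtain N where N: "\<And>g x y. g \<in> G \<Longrightarrow> x \<in> S \<Longrightarrow> y \<in> S \<Longrightarrow> (\<forall>i<N g. x i = y i) \<Longrightarrow> g x = g y"
    using G unfolding finitely_determined_on_def by metis
  obtain n where n: "\<And>g. g \<in> G \<Longrightarrow> N g \<le> n"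
    using finite_nat_set_iff_bounded_le[of "N ` G"] \<open>finite G\<close> by blast
  show ?thesis
    unfolding finitely_determined_on_def
  proof (intro exI[of _ n] ballI impI)
    fix x y assume xy: "x \<in> S" "y \<in> S" "\<forall>i<n. x i = y i"
    show "h x = h y"
    proof (rule h[OF xy(1,2)])
      fix g assume "g \<in> G"
      with xy n show "g x = g y"
        by (meson N order_less_le_trans)
    qed
  qed
qed

lemma CF_compose:
  assumes "g \<in> CF X A" "continuous_map A B h"
  shows "(\<lambda>x. h (g x)) \<in> CF X B"
  using assms finitely_determined_on_combine[of "{g}" "topspace X" "\<lambda>x. h (g x)"]
    continuous_map_compose[of X A g B h]
  by (simp add: CF_def o_def)

lemma CF_const: "y \<in> topspace A \<Longrightarrow> (\<lambda>x. y) \<in> CF X A"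
  by (simp add: CF_def finitely_determined_on_def)

lemma CF_compose2:
  assumes "g \<in> CF X A" "h \<in> CF X A" "continuous_map (prod_topology A A) B r"
  shows "(\<lambda>x. r (g x, h x)) \<in> CF X B"
proof -
  have "continuous_map X (prod_topology A A) (\<lambda>x. (g x, h x))"
    using assms by (simp add: CF_def continuous_map_paired)
  then have "continuous_map X B (\<lambda>x. r (g x, h x))"
    using assms(3) continuous_map_compose[of X "prod_topology A A" "\<lambda>x. (g x, h x)" B r]
    by (simp add: o_def)
  moreover have "finitely_determined_on (topspace X) (\<lambda>x. r (g x, h x))"
  proof (rule finitely_determined_on_combine[of "{g, h}"])
    fix x y assume "\<And>k. k \<in> {g, h} \<Longrightarrow> k x = k y"
    from this[of g] this[of h] show "r (g x, h x) = r (g y, h y)"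
      by simp
  qed (use assms in \<open>auto simp: CF_def\<close>)
  ultimately show ?thesis
    by (simp add: CF_def)
qed

lemma CF_sum:
  fixes c :: "'i \<Rightarrow> (nat \<Rightarrow> 'a) \<Rightarrow> real"
  assumes "finite I" "\<And>i. i \<in> I \<Longrightarrow> c i \<in> CF X euclideanreal"
  shows "(\<lambda>x. \<Sum>i\<in>I. c i x) \<in> CF X euclideanreal"
proof -
  have "finitely_determined_on (topspace X) (\<lambda>x. \<Sum>i\<in>I. c i x)"
    by (rule finitely_determined_on_combine[of "c ` I"]) (use assms in \<open>auto simp: CF_def intro: sum.cong\<close>)
  then show ?thesis
    using assms by (auto simp: CF_def intro: continuous_map_sum)
qed

lemma CF_prod:
  fixes c :: "'i \<Rightarrow> (nat \<Rightarrow> 'a) \<Rightarrow> real"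
  assumes "finite I" "\<And>i. i \<in> I \<Longrightarrow> c i \<in> CF X euclideanreal"
  shows "(\<lambda>x. \<Prod>i\<in>I. c i x) \<in> CF X euclideanreal"
proof -
  have "finitely_determined_on (topspace X) (\<lambda>x. \<Prod>i\<in>I. c i x)"
    by (rule finitely_determined_on_combine[of "c ` I"]) (use assms in \<open>auto simp: CF_def intro: prod.cong\<close>)
  then show ?thesis
    using assms by (auto simp: CF_def intro: continuous_map_prod)
qed

lemma CF_subtopology:
  assumes "g \<in> CF P A"
  shows "g \<in> CF (subtopology P S) A"
  using assms unfolding CF_def finitely_determined_on_def
  by (auto simp: continuous_map_from_subtopology)

lemma CF_coordinate:
  assumes "continuous_map (Xs i) A h"
  shows "(\<lambda>x. h (x i)) \<in> CF (product_topology Xs UNIV) A"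
proof -
  have "continuous_map (product_topology Xs UNIV) A (\<lambda>x. h (x i))"
    using continuous_map_compose[OF continuous_map_product_projection[of i UNIV Xs] assms]
    by (simp add: o_def)
  then show ?thesis
    by (auto simp: CF_def finitely_determined_on_def intro!: exI[of _ "Suc i"])
qed

section \<open>Zero sets of countable families of finitely determined functions\<close>

text \<open>A countable family is allowed because each member may need its own number of
  coordinates; zero sets of single functions in \<open>CF\<close> are in general not closed under
  countable intersections.\<close>

definition CF_zero_set :: "(nat \<Rightarrow> 'a) topology \<Rightarrow> (nat \<Rightarrow> 'a) set \<Rightarrow> bool" where
  "CF_zero_set X Z \<longleftrightarrow>
     (\<exists>C. countable C \<and> C \<subseteq> CF X euclideanreal \<and> Z = {x \<in> topspace X. \<forall>c\<in>C. c x = 0})"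

text \<open>This is the only property of the domain that the approximation argument uses; each of
  the two alternative hypotheses on the spaces is shown to imply it.\<close>

definition CF_zero_separating :: "(nat \<Rightarrow> 'a) topology \<Rightarrow> bool" where
  "CF_zero_separating X \<longleftrightarrow>
     (\<forall>F U. closedin X F \<longrightarrow> openin X U \<longrightarrow> F \<subseteq> U \<longrightarrow> (\<exists>Z. CF_zero_set X Z \<and> F \<subseteq> Z \<and> Z \<subseteq> U))"

lemma CF_zero_set_INT:
  assumes "\<And>n::nat. CF_zero_set X (Z n)"
  shows "CF_zero_set X (\<Inter>n. Z n)"
proof -
  have "\<forall>n. \<exists>C. countable C \<and> C \<subseteq> CF X euclideanreal \<and> Z n = {x \<in> topspace X. \<forall>c\<in>C. c x = 0}"
    using assms unfolding CF_zero_set_def by blast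
  from choice[OF this] obtain C where
    C: "\<forall>n. countable (C n) \<and> C n \<subseteq> CF X euclideanreal \<and> Z n = {x \<in> topspace X. \<forall>c\<in>C n. c x = 0}"
    by (rule exE)
  show ?thesis
    unfolding CF_zero_set_def
    by (rule exI[of _ "\<Union>n. C n"]) (use C in auto)
qed

text \<open>A sum of the first \<open>n\<close> absolute values is finite, hence stays in
  \<open>CF\<close>. Multiplied by \<open>n\<close> and cut off at 1, it vanishes on
  \<open>Z\<close> and reaches 1 elsewhere once \<open>n\<close> dominates the inverse of one
  nonzero value. Exact values, not mere limits, allow indices to be counted later.\<close>

lemma CF_zero_set_indicator:
  assumes "CF_zero_set X Z"
  shows "\<exists>b. (\<forall>n. b n \<in> CF X euclideanreal) \<and> (\<forall>n x. x \<in> Z \<longrightarrow> b n x = 0) \<and>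
    (\<forall>x. x \<in> topspace X - Z \<longrightarrow> (\<forall>\<^sub>F n in sequentially. b n x = (1::real)))"
proof -
  obtain C where C: "countable C" "C \<subseteq> CF X euclideanreal" "Z = {x \<in> topspace X. \<forall>c\<in>C. c x = 0}"
    using assms unfolding CF_zero_set_def by blast
  \<comment> \<open>Adding the zero function makes the family nonempty, as its enumeration requires,
    without changing the common zero set.\<close>
  define c where "c = from_nat_into (insert (\<lambda>x. 0) C)"
  have ran: "range c = insert (\<lambda>x. 0) C"
    unfolding c_def using C(1) by (intro range_from_nat_into) auto
  have cCF: "c m \<in> CF X euclideanreal" for m
    using ran C(2) CF_const[of 0 euclideanreal X] by (metis UNIV_I insertE rangeI subsetD topspace_euclidean)
  define b where "b = (\<lambda>n x. min 1 (real n * (\<Sum>m<n. \<bar>c m x\<bar>)))"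
  show ?thesis
  proof (intro exI[of _ b] conjI allI impI)
    fix n
    have "(\<lambda>x. \<bar>c m x\<bar>) \<in> CF X euclideanreal" for m
      using cCF by (rule CF_compose) (intro continuous_map_real_abs continuous_map_id[unfolded id_def])
    then have *: "(\<lambda>x. \<Sum>m<n. \<bar>c m x\<bar>) \<in> CF X euclideanreal"
      by (intro CF_sum) auto
    show "b n \<in> CF X euclideanreal"
      unfolding b_def
      by (rule CF_compose[OF *, where h = "\<lambda>s. min 1 (real n * s)"]) (auto intro!: continuous_intros)
  next
    fix n x assume "x \<in> Z"
    then have "c m x = 0" for m
      using C(3) ran by (metis (mono_tags, lifting) insertE mem_Collect_eq rangeI)
    then show "b n x = 0"
      by (simp add: b_def)
  next
    fix x assume "x \<in> topspace X - Z"
    then obtain c' where c': "c' \<in> C" "c' x \<noteq> 0"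
      using C(3) by blast
    then have "c' \<in> range c"
      using ran by blast
    then obtain m where m: "c m x \<noteq> 0"
      using c'(2) by blast
    obtain k :: nat where k: "1 / \<bar>c m x\<bar> \<le> real k"
      using real_arch_simple by blast
    show "\<forall>\<^sub>F n in sequentially. b n x = 1"
      unfolding eventually_sequentially
    proof (intro exI[of _ "max k (Suc m)"] allI impI)
      fix n assume n: "max k (Suc m) \<le> n"
      have "1 \<le> real k * \<bar>c m x\<bar>"
        using k m by (simp add: field_simps)
      also have "\<dots> \<le> real n * (\<Sum>m<n. \<bar>c m x\<bar>)"
        using n by (intro mult_mono member_le_sum) auto
      finally show "b n x = 1"
        by (simp add: b_def)
    qed
  qed
qed

section \<open>From first hits to values along paths\<close>

text \<open>Paths between consecutive points are run in unit time and concatenated, so that an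
  index, read as a time, is sent to its point.\<close>

lemma path_through_points:
  assumes "path_connected_space Y" and t: "\<And>j::nat. t j \<in> topspace Y"
  shows "\<exists>\<gamma>. continuous_map euclideanreal Y \<gamma> \<and> (\<forall>j\<le>n. \<gamma> (real j) = t j)"
proof (induction n)
  case 0
  show ?case
    by (rule exI[of _ "\<lambda>_. t 0"]) (use t in auto)
next
  case (Suc n)
  then obtain \<gamma> where \<gamma>: "continuous_map euclideanreal Y \<gamma>" "\<And>j. j \<le> n \<Longrightarrow> \<gamma> (real j) = t j"
    by blast
  obtain p where p: "pathin Y p" "p 0 = t n" "p 1 = t (Suc n)"
    using assms unfolding path_connected_space_def by metis
  \<comment> \<open>Clamping the shifted time to the unit interval extends \<open>p\<close> to the
    whole line; at time \<open>n\<close> the value is \<open>t n\<close>, where \<open>q\<close> has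
    to agree with \<open>\<gamma>\<close>.\<close>
  define q where "q = (\<lambda>s. p (max 0 (min 1 (s - real n))))"
  have "continuous_map euclideanreal (subtopology euclideanreal {0..1}) (\<lambda>s. max 0 (min 1 (s - real n)))"
    by (auto simp: continuous_map_in_subtopology intro!: continuous_intros)
  then have q: "continuous_map euclideanreal Y q"
    using p(1) continuous_map_compose[of _ _ _ Y p] unfolding pathin_def q_def by (fastforce simp: o_def)
  have "continuous_map euclideanreal Y (\<lambda>s. if s \<le> real n then \<gamma> s else q s)"
    by (rule continuous_map_cases_le)
      (use \<gamma> q p in \<open>auto intro: continuous_map_from_subtopology simp: q_def\<close>)
  moreover have "\<forall>j\<le>Suc n. (if real j \<le> real n then \<gamma> (real j) else q (real j)) = t j"
    using \<gamma> p by (auto simp: q_def le_Suc_eq)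
  ultimately show ?case
    by (intro exI[of _ "\<lambda>s. if s \<le> real n then \<gamma> s else q s"]) auto
qed

text \<open>The functions \<open>s n\<close> in the proof converge, stationarily at each point, to the index of the
  first zero set containing the point; a path through the points \<open>t j\<close> turns indices into values.\<close>

lemma CF_approximation_of_first_hit:
  fixes X :: "(nat \<Rightarrow> 'a) topology" and Y :: "'b topology"
  assumes pc: "path_connected_space Y" and t: "\<And>j::nat. t j \<in> topspace Y"
    and Z: "\<And>j. CF_zero_set X (Z j)"
  obtains g where "\<And>n::nat. g n \<in> CF X Y"
    "\<And>x. x \<in> (\<Union>j. Z j) \<Longrightarrow> \<forall>\<^sub>F n in sequentially. g n x = t (LEAST j. x \<in> Z j)"
proof -
  have "\<forall>j. \<exists>b. (\<forall>n. b n \<in> CF X euclideanreal) \<and> (\<forall>n x. x \<in> Z j \<longrightarrow> b n x = 0) \<and>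
      (\<forall>x. x \<in> topspace X - Z j \<longrightarrow> (\<forall>\<^sub>F n in sequentially. b n x = (1::real)))"
    using CF_zero_set_indicator[OF Z] by (rule allI)
  from choice[OF this] obtain b where b: "\<And>j n. b j n \<in> CF X euclideanreal"
    "\<And>j n x. x \<in> Z j \<Longrightarrow> b j n x = 0"
    "\<And>j x. x \<in> topspace X - Z j \<Longrightarrow> \<forall>\<^sub>F n in sequentially. b j n x = (1::real)"
    by blast
  \<comment> \<open>If \<open>J\<close> is the first index with \<open>x\<close> in
    \<open>Z J\<close>, the \<open>j\<close>-th product is exactly 0 for \<open>j \<ge> J\<close>,
    because of its factor \<open>i = J\<close>, and eventually 1 for each \<open>j < J\<close>. So
    the sum counts the indices below \<open>J\<close>.\<close>
  define s where "s = (\<lambda>n x. \<Sum>j<n. \<Prod>i\<le>j. b i n x)"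
  have "\<forall>n. \<exists>\<gamma>. continuous_map euclideanreal Y \<gamma> \<and> (\<forall>j\<le>n. \<gamma> (real j) = t j)"
    by (intro allI path_through_points[OF pc t])
  from choice[OF this] obtain \<gamma> where \<gamma>:
    "\<And>n. continuous_map euclideanreal Y (\<gamma> n)" "\<And>n j. j \<le> n \<Longrightarrow> \<gamma> n (real j) = t j"
    by blast
  show thesis
  proof
    fix n :: nat
    show "(\<lambda>x. \<gamma> n (s n x)) \<in> CF X Y"
      by (rule CF_compose[OF _ \<gamma>(1)]) (auto simp: s_def intro!: CF_sum CF_prod b(1))
  next
    fix x assume "x \<in> (\<Union>j. Z j)"
    then have "\<exists>j. x \<in> Z j"
      by blast
    define J where "J = (LEAST j. x \<in> Z j)"
    have J: "x \<in> Z J" "\<And>i. i < J \<Longrightarrow> x \<notin> Z i"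
      unfolding J_def using \<open>\<exists>j. x \<in> Z j\<close> by (rule LeastI_ex) (rule not_less_Least)
    have "x \<in> topspace X"
      using J(1) Z unfolding CF_zero_set_def by blast
    then have "\<forall>\<^sub>F n in sequentially. \<forall>i\<in>{..<J}. b i n x = 1"
      using J(2) b(3) by (intro eventually_ball_finite) auto
    \<comment> \<open>The bound \<open>n \<ge> J\<close> ensures that the sum contains all
      \<open>J\<close> unit terms and that \<open>\<gamma> n\<close> passes through
      \<open>t J\<close>.\<close>
    then show "\<forall>\<^sub>F n in sequentially. \<gamma> n (s n x) = t (LEAST j. x \<in> Z j)"
      using eventually_ge_at_top[of J]
    proof eventually_elim
      case (elim n)
      have "s n x = (\<Sum>j<n. if j < J then 1 else 0)"
        unfolding s_def
      proof (rule sum.cong[OF refl])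
        fix j
        show "(\<Prod>i\<le>j. b i n x) = (if j < J then 1 else 0)"
        proof (cases "j < J")
          case True
          then show ?thesis using elim by (auto intro!: prod.neutral)
        next
          case False
          then show ?thesis using b(2)[OF J(1)] by (auto intro!: prod_zero bexI[of _ J])
        qed
      qed
      also have "\<dots> = (\<Sum>j<J. 1)"
        using elim by (intro sum.mono_neutral_cong_right) auto
      finally show ?case
        using \<gamma>(2)[of J n] elim by (simp add: J_def)
    qed
  qed
qed

section \<open>Approximation of Lebesgue one maps\<close>

text \<open>With \<open>A\<close> the union of closed sets \<open>F k\<close> and \<open>B\<close>
  the intersection of open sets \<open>G m\<close>, every \<open>F k\<close> lies in every
  \<open>G m\<close>. Separating each pair and intersecting over \<open>m\<close> gives one zero set
  between \<open>F k\<close> and \<open>B\<close>.\<close>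

lemma CF_zero_sets_between_fsigma_gdelta:
  assumes sep: "CF_zero_separating X" and "fsigma_in X A" "gdelta_in X B" "A \<subseteq> B"
  shows "\<exists>Z. (\<forall>k::nat. CF_zero_set X (Z k)) \<and> A \<subseteq> (\<Union>k. Z k) \<and> (\<Union>k. Z k) \<subseteq> B"
proof -
  obtain F where F: "\<forall>k. closedin X (F k)" "\<forall>k. F k \<subseteq> F (Suc k)" "\<Union>(range F) = A"
    using \<open>fsigma_in X A\<close> unfolding fsigma_in_ascending by (elim exE conjE)
  obtain G where G: "\<forall>m. openin X (G m)" "\<forall>m. G (Suc m) \<subseteq> G m" "\<Inter>(range G) = B"
    using \<open>gdelta_in X B\<close> unfolding gdelta_in_descending by (elim exE conjE)
  have FG: "F k \<subseteq> G m" for k m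
    using F(3) G(3) \<open>A \<subseteq> B\<close> by blast
  have "\<exists>Z. CF_zero_set X Z \<and> F k \<subseteq> Z \<and> Z \<subseteq> G m" for k m
    using sep F(1) G(1) FG[of k m] unfolding CF_zero_separating_def by simp
  then obtain Z where Z: "\<And>k m. CF_zero_set X (Z k m)" "\<And>k m. F k \<subseteq> Z k m" "\<And>k m. Z k m \<subseteq> G m"
    by metis
  show ?thesis
  proof (intro exI conjI allI)
    show "CF_zero_set X (\<Inter>m. Z k m)" for k
      using Z(1) by (rule CF_zero_set_INT)
    show "A \<subseteq> (\<Union>k. \<Inter>m. Z k m)"
      using F(3) Z(2) by blast
    show "(\<Union>k. \<Inter>m. Z k m) \<subseteq> B"
      using G(3) Z(3) by blast
  qed
qed

text \<open>Open balls have F-sigma preimages; complements of closed balls are open, so closed balls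
  have G-delta preimages.\<close>

lemma Lebesgue_one_preimage_cover:
  assumes sep: "CF_zero_separating X" and f: "f \<in> Lebesgue_one X (mtopology_of Y)"
  shows "\<exists>Z. (\<forall>k::nat. CF_zero_set X (Z k)) \<and>
    {x \<in> topspace X. f x \<in> mball_of Y y e} \<subseteq> (\<Union>k. Z k) \<and>
    (\<Union>k. Z k) \<subseteq> {x \<in> topspace X. f x \<in> mcball_of Y y e}"
proof (rule CF_zero_sets_between_fsigma_gdelta[OF sep])
  interpret Y: Metric_space "mspace Y" "mdist Y"
    by (rule Metric_space_mspace_mdist)
  have "openin (mtopology_of Y) (mball_of Y y e)"
    by (simp add: mball_of_def mtopology_of_def)
  then show "fsigma_in X {x \<in> topspace X. f x \<in> mball_of Y y e}"
    using f unfolding Lebesgue_one_def by blast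
  have "openin (mtopology_of Y) (mspace Y - mcball_of Y y e)"
    by (metis Y.closedin_mcball Y.topspace_mtopology mcball_of_def mtopology_of_def openin_diff openin_topspace)
  then have "fsigma_in X {x \<in> topspace X. f x \<in> mspace Y - mcball_of Y y e}"
    using f unfolding Lebesgue_one_def by blast
  moreover have "{x \<in> topspace X. f x \<in> mspace Y - mcball_of Y y e}
      = topspace X - {x \<in> topspace X. f x \<in> mcball_of Y y e}"
    using f by (auto simp: Lebesgue_one_def)
  ultimately show "gdelta_in X {x \<in> topspace X. f x \<in> mcball_of Y y e}"
    by (simp add: gdelta_in_fsigma_in)
  show "{x \<in> topspace X. f x \<in> mball_of Y y e} \<subseteq> {x \<in> topspace X. f x \<in> mcball_of Y y e}"
    by auto
qed

text \<open>Eventual equality with \<open>h\<close>, rather than convergence to it, is recorded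
  because it survives the later composition with the retractions. The map \<open>h\<close> itself
  need not be continuous.\<close>

lemma Lebesgue_one_stationary_approximation:
  fixes Y :: "'b metric"
  assumes sep: "CF_zero_separating X" and f: "f \<in> Lebesgue_one X (mtopology_of Y)"
    and pc: "path_connected_space (mtopology_of Y)" and "separable_space (mtopology_of Y)"
    and ne: "mspace Y \<noteq> {}" and "e > 0"
  shows "\<exists>g h. (\<forall>n::nat. g n \<in> CF X (mtopology_of Y)) \<and>
    (\<forall>x\<in>topspace X. h x \<in> mspace Y \<and> mdist Y (h x) (f x) \<le> e \<and> (\<forall>\<^sub>F n in sequentially. g n x = h x))"
proof -
  interpret Y: Metric_space "mspace Y" "mdist Y"
    by (rule Metric_space_mspace_mdist)
  obtain D where D: "countable D" "D \<subseteq> mspace Y" "mtopology_of Y closure_of D = mspace Y"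
    using \<open>separable_space _\<close> unfolding separable_space_def by auto
  have dense: "\<exists>d\<in>D. mdist Y d y < e" if "y \<in> mspace Y" for y
  proof -
    have "y \<in> Y.mtopology closure_of D"
      using that D(3) by (simp add: mtopology_of_def)
    then obtain d where "d \<in> D" "d \<in> Y.mball y e"
      using \<open>e > 0\<close> unfolding Y.metric_closure_of by blast
    then show ?thesis
      by (auto simp: Y.commute)
  qed
  then have "D \<noteq> {}"
    using ne by blast
  define d where "d = from_nat_into D"
  have d: "range d = D"
    unfolding d_def using \<open>D \<noteq> {}\<close> D(1) by (rule range_from_nat_into)
  define A where "A = (\<lambda>i. {x \<in> topspace X. f x \<in> mball_of Y (d i) e})"
  define B where "B = (\<lambda>i. {x \<in> topspace X. f x \<in> mcball_of Y (d i) e})"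
  have "\<exists>Z. (\<forall>k::nat. CF_zero_set X (Z k)) \<and> A i \<subseteq> (\<Union>k. Z k) \<and> (\<Union>k. Z k) \<subseteq> B i" for i
    unfolding A_def B_def by (rule Lebesgue_one_preimage_cover[OF sep f])
  then obtain Z where Z: "\<And>i k::nat. CF_zero_set X (Z i k)"
    "\<And>i. A i \<subseteq> (\<Union>k. Z i k)" "\<And>i. (\<Union>k. Z i k) \<subseteq> B i"
    by metis
  \<comment> \<open>One index \<open>j\<close> codes a ball \<open>i\<close> together with a zero
    set \<open>k\<close> over it, so that a first hit can be taken over the whole double
    family.\<close>
  define t where "t = (\<lambda>j. d (fst (prod_decode j)))"
  define W where "W = (\<lambda>j. case prod_decode j of (i, k) \<Rightarrow> Z i k)"
  have t: "t j \<in> topspace (mtopology_of Y)" for j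
    using d D(2) by (auto simp: t_def)
  have W: "CF_zero_set X (W j)" for j
    by (simp add: W_def Z(1) split: prod.split)
  have near: "mdist Y (t j) (f x) \<le> e" if "x \<in> W j" for x j
  proof -
    obtain i k where ik: "prod_decode j = (i, k)" by force
    with that have "x \<in> Z i k" by (simp add: W_def)
    then have "f x \<in> mcball_of Y (d i) e" using Z(3)[of i] unfolding B_def by blast
    then show ?thesis using ik by (simp add: t_def)
  qed
  have cover: "x \<in> (\<Union>j. W j)" if x: "x \<in> topspace X" for x
  proof -
    have "f x \<in> mspace Y"
      using f x by (auto simp: Lebesgue_one_def)
    then obtain i where "f x \<in> mball_of Y (d i) e"
      using dense[of "f x"] d D(2) by fastforce
    then obtain k where "x \<in> Z i k"
      using Z(2)[of i] x unfolding A_def by blast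
    then have "x \<in> W (prod_encode (i, k))"
      by (simp add: W_def)
    then show ?thesis by blast
  qed
  obtain g where g: "\<And>n::nat. g n \<in> CF X (mtopology_of Y)"
    "\<And>x. x \<in> (\<Union>j. W j) \<Longrightarrow> \<forall>\<^sub>F n in sequentially. g n x = t (LEAST j. x \<in> W j)"
    using CF_approximation_of_first_hit[of "mtopology_of Y" t X W] pc t W by blast
  have "mdist Y (t (LEAST j. x \<in> W j)) (f x) \<le> e" if "x \<in> topspace X" for x
  proof -
    have "\<exists>j. x \<in> W j" using cover[OF that] by blast
    then show ?thesis by (rule near[OF LeastI_ex])
  qed
  then show ?thesis
    using g cover t by (intro exI[of _ g] exI[of _ "\<lambda>x. t (LEAST j. x \<in> W j)"]) auto
qed

text \<open>Retracting the next approximation towards the current one keeps consecutive approximations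
  close everywhere, not only where they have already stabilised; so the diagonal converges.\<close>

lemma Lebesgue_one_limit_of_CF:
  fixes Y :: "'b metric"
  assumes sep: "CF_zero_separating X" and f: "f \<in> Lebesgue_one X (mtopology_of Y)"
    and pc: "path_connected_space (mtopology_of Y)" and separable: "separable_space (mtopology_of Y)"
    and ne: "mspace Y \<noteq> {}" and "R_space Y"
  shows "\<exists>g. (\<forall>k::nat. g k \<in> CF X (mtopology_of Y)) \<and>
             (\<forall>x\<in>topspace X. limitin (mtopology_of Y) (\<lambda>k. g k x) (f x) sequentially)"
proof -
  interpret Y: Metric_space "mspace Y" "mdist Y"
    by (rule Metric_space_mspace_mdist)
  define e :: "nat \<Rightarrow> real" where "e = (\<lambda>m. (1/2) ^ m)"
  have e: "e m > 0" for m by (simp add: e_def)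
  have "\<forall>m. \<exists>r. continuous_map (prod_topology (mtopology_of Y) (mtopology_of Y)) (mtopology_of Y) r \<and>
      (\<forall>y\<in>mspace Y. \<forall>z\<in>mspace Y.
         (mdist Y y z \<le> e m \<longrightarrow> r (y, z) = y) \<and> mdist Y (r (y, z)) z \<le> e m)"
    using \<open>R_space Y\<close> e unfolding R_space_def by blast
  from choice[OF this] obtain r where r: "\<And>m. continuous_map (prod_topology (mtopology_of Y) (mtopology_of Y)) (mtopology_of Y) (r m)"
    "\<And>m y z. y \<in> mspace Y \<Longrightarrow> z \<in> mspace Y \<Longrightarrow> mdist Y y z \<le> e m \<Longrightarrow> r m (y, z) = y"
    "\<And>m y z. y \<in> mspace Y \<Longrightarrow> z \<in> mspace Y \<Longrightarrow> mdist Y (r m (y, z)) z \<le> e m"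
    by blast
  \<comment> \<open>Precision \<open>e m / 2\<close> keeps \<open>h m\<close> and
    \<open>h (Suc m)\<close> at most \<open>e m\<close> apart, the range in which \<open>r m\<close>
    returns its first argument.\<close>
  have "\<forall>m. \<exists>g h. (\<forall>n::nat. g n \<in> CF X (mtopology_of Y)) \<and>
    (\<forall>x\<in>topspace X. h x \<in> mspace Y \<and> mdist Y (h x) (f x) \<le> e m / 2 \<and> (\<forall>\<^sub>F n in sequentially. g n x = h x))"
    using e by (intro allI Lebesgue_one_stationary_approximation[OF sep f pc separable ne]) simp
  then obtain g h where g: "\<And>m n. g m n \<in> CF X (mtopology_of Y)"
    and h: "\<And>m x. x \<in> topspace X \<Longrightarrow> h m x \<in> mspace Y"
      "\<And>m x. x \<in> topspace X \<Longrightarrow> mdist Y (h m x) (f x) \<le> e m / 2"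
      "\<And>m x. x \<in> topspace X \<Longrightarrow> \<forall>\<^sub>F n in sequentially. g m n x = h m x"
    by metis
  \<comment> \<open>In \<open>u n m\<close>, \<open>n\<close> is the stage of the approximating
    sequences and \<open>m\<close> the level of precision; \<open>r m\<close> pulls
    \<open>g (Suc m) n\<close> to within \<open>e m\<close> of \<open>u n m\<close>, at every point
    and every stage.\<close>
  define u where "u = (\<lambda>n. rec_nat (g 0 n) (\<lambda>m v x. r m (g (Suc m) n x, v x)))"
  have u_0: "u n 0 = g 0 n" and u_Suc: "u n (Suc m) = (\<lambda>x. r m (g (Suc m) n x, u n m x))" for n m
    by (simp_all add: u_def)
  have u: "u n m \<in> CF X (mtopology_of Y)" for n m
    by (induction m) (simp_all add: u_0 u_Suc g CF_compose2[OF g _ r(1)])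
  have CF_in: "v x \<in> mspace Y" if "v \<in> CF X (mtopology_of Y)" "x \<in> topspace X" for v x
    using that by (auto simp: CF_def continuous_map_def)
  note u_in = CF_in[OF u]
  have fx: "f x \<in> mspace Y" if "x \<in> topspace X" for x
    using f that by (auto simp: Lebesgue_one_def)
  have step: "mdist Y (u n (Suc m) x) (u n m x) \<le> e m" if "x \<in> topspace X" for n m x
    using r(3) CF_in[OF g that] u_in[OF that] by (simp add: u_Suc)
  \<comment> \<open>The steps beyond level \<open>M\<close> are bounded by \<open>e M\<close>,
    \<open>e (M + 1)\<close> and so on; the difference on the right is the partial sum of this
    geometric series. The bound is uniform in \<open>n\<close>.\<close>
  have dist_u: "mdist Y (u n (M + k) x) (u n M x) \<le> 2 * e M - 2 * e (M + k)" if x: "x \<in> topspace X" for n M k x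
  proof (induction k)
    case 0
    then show ?case using u_in[OF x] by simp
  next
    case (Suc k)
    have "mdist Y (u n (Suc (M + k)) x) (u n M x)
        \<le> mdist Y (u n (Suc (M + k)) x) (u n (M + k) x) + mdist Y (u n (M + k) x) (u n M x)"
      using u_in[OF x] by (intro Y.triangle) auto
    also have "\<dots> \<le> e (M + k) + (2 * e M - 2 * e (M + k))"
      using step[OF x] Suc by (intro add_mono)
    finally show ?case by (simp add: e_def)
  qed
  \<comment> \<open>Eventually the arguments of \<open>r m\<close> are \<open>h (Suc m) x\<close>
    and \<open>h m x\<close>, close enough for the first one to be returned unchanged.\<close>
  have stable: "\<forall>\<^sub>F n in sequentially. u n m x = h m x" if x: "x \<in> topspace X" for m x
  proof (induction m)
    case 0
    then show ?case using h(3)[OF x] by (simp add: u_0)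
  next
    case (Suc m)
    have "mdist Y (h (Suc m) x) (h m x) \<le> mdist Y (h (Suc m) x) (f x) + mdist Y (h m x) (f x)"
      using h(1)[OF x] fx[OF x] by (metis Y.commute Y.triangle)
    also have "\<dots> \<le> e (Suc m) / 2 + e m / 2"
      using h(2)[OF x] by (intro add_mono)
    also have "\<dots> \<le> e m"
      by (simp add: e_def)
    finally have *: "r m (h (Suc m) x, h m x) = h (Suc m) x"
      using r(2) h(1)[OF x] by blast
    from h(3)[OF x, of "Suc m"] Suc show ?case
      by eventually_elim (simp add: u_Suc *)
  qed
  have "limitin (mtopology_of Y) (\<lambda>n. u n n x) (f x) sequentially" if x: "x \<in> topspace X" for x
    unfolding mtopology_of_def Y.limitin_metric
  proof (intro conjI allI impI)
    show "f x \<in> mspace Y" using fx[OF x] .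
    fix \<delta> :: real assume "\<delta> > 0"
    then obtain M where M: "e M < \<delta> / 3"
      using real_arch_pow_inv[of "\<delta> / 3" "1/2"] by (auto simp: e_def)
    \<comment> \<open>The level \<open>M\<close> stays fixed while \<open>n\<close> grows:
      \<open>u n M x\<close> becomes \<open>h M x\<close>, and the diagonal value stays within
      \<open>2 * e M\<close> of it even if level \<open>n\<close> has not stabilised.\<close>
    show "\<forall>\<^sub>F n in sequentially. u n n x \<in> mspace Y \<and> mdist Y (u n n x) (f x) < \<delta>"
      using stable[OF x, of M] eventually_ge_at_top[of M]
    proof eventually_elim
      case (elim n)
      have "mdist Y (u n n x) (f x) \<le> mdist Y (u n n x) (u n M x) + mdist Y (u n M x) (f x)"
        using u_in[OF x] fx[OF x] by (intro Y.triangle) auto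
      also have "\<dots> \<le> 2 * e M + e M / 2"
        using dist_u[OF x, of n M "n - M"] elim h(2)[OF x, of M] e[of n] by simp
      also have "\<dots> < \<delta>"
        using M e[of M] by simp
      finally show ?case using u_in[OF x] by simp
    qed
  qed
  then show ?thesis
    using u by (intro exI[of _ "\<lambda>n. u n n"]) auto
qed

section \<open>Zero set separation in subspaces of products\<close>

lemma openin_product_topology_box:
  assumes "openin (product_topology Xs UNIV) U" "x \<in> U"
  shows "\<exists>V. finite {i. V i \<noteq> topspace (Xs i)} \<and> (\<forall>i. openin (Xs i) (V i)) \<and>
    x \<in> Pi\<^sub>E UNIV V \<and> Pi\<^sub>E UNIV V \<subseteq> U"
  using assms unfolding openin_product_topology_alt by simp

text \<open>\<open>U\<close> and the cozero sets of those functions in \<open>CF\<close> that vanish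
  on \<open>F\<close> cover the space. The functions behind a countable subcover have their common
  zeros inside \<open>U\<close>.\<close>

lemma CF_zero_separating_Lindelof:
  assumes creg: "\<And>n. completely_regular_space (Xs n)"
    and "Lindelof_space (subtopology (product_topology Xs UNIV) S)"
  shows "CF_zero_separating (subtopology (product_topology Xs UNIV) S)"
  unfolding CF_zero_separating_def
proof (intro allI impI)
  let ?P = "product_topology Xs UNIV"
  let ?X = "subtopology ?P S"
  let ?coz = "\<lambda>c::_ \<Rightarrow> real. {x \<in> topspace ?X. c x \<noteq> 0}"
  fix F U assume F: "closedin ?X F" and U: "openin ?X U" and "F \<subseteq> U"
  define A where "A = {c \<in> CF ?X euclideanreal. \<forall>x\<in>F. c x = 0}"
  have point: "\<exists>c\<in>A. c x \<noteq> 0" if x: "x \<in> topspace ?X - F" for x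
  proof -
    obtain O' where O': "openin ?P O'" "topspace ?X - F = O' \<inter> S"
      using F unfolding closedin_def openin_subtopology by blast
    have "x \<in> O'"
      using x O'(2) by blast
    obtain V where V: "finite {i. V i \<noteq> topspace (Xs i)}" "\<And>i. openin (Xs i) (V i)"
      "x \<in> Pi\<^sub>E UNIV V" "Pi\<^sub>E UNIV V \<subseteq> O'"
      using openin_product_topology_box[OF O'(1) \<open>x \<in> O'\<close>] by blast
    have "\<forall>i. \<exists>h. continuous_map (Xs i) euclideanreal h \<and> h (x i) = 0 \<and> h ` (topspace (Xs i) - V i) \<subseteq> {1}"
      using creg V(2,3) unfolding completely_regular_space_alt' by (metis PiE_mem UNIV_I)
    then obtain h where h: "\<And>i. continuous_map (Xs i) euclideanreal (h i)" "\<And>i. h i (x i) = 0"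
      "\<And>i. h i ` (topspace (Xs i) - V i) \<subseteq> {1::real}"
      by metis
    \<comment> \<open>Only the finitely many restricted coordinates enter, so \<open>c\<close> is
      finitely determined. It is 1 at \<open>x\<close>, while a point of \<open>F\<close> leaves the
      box in a restricted coordinate, whose factor then vanishes.\<close>
    define c where "c = (\<lambda>y. \<Prod>i | V i \<noteq> topspace (Xs i). 1 - h i (y i))"
    have "c \<in> CF ?P euclideanreal"
      unfolding c_def
      by (rule CF_prod[OF V(1)]) (auto intro!: CF_coordinate[where h = "\<lambda>s. 1 - h _ s"] continuous_intros h(1))
    then have "c \<in> CF ?X euclideanreal"
      by (rule CF_subtopology)
    moreover have "c y = 0" if "y \<in> F" for y
    proof -
      have "y \<in> topspace ?P" "y \<in> S"
        using that F closedin_subset by fastforce+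
      have "y \<notin> O'"
        using O'(2) that \<open>y \<in> S\<close> by blast
      then obtain i where i: "y i \<notin> V i"
        using V(4) by auto
      then have "y i \<in> topspace (Xs i) - V i"
        using \<open>y \<in> topspace ?P\<close> by auto
      then have "h i (y i) = 1" "V i \<noteq> topspace (Xs i)"
        using h(3) by auto
      then show ?thesis
        unfolding c_def using V(1) by (intro prod_zero) auto
    qed
    moreover have "c x \<noteq> 0"
      by (simp add: c_def h(2))
    ultimately show ?thesis
      by (auto simp: A_def)
  qed
  have "openin ?X W" if W: "W \<in> insert U (?coz ` A)" for W
  proof (cases "W = U")
    case False
    with W have "W \<in> ?coz ` A"
      by simp
    then obtain c where c: "c \<in> A" "W = ?coz c"
      by (rule imageE)
    then have "continuous_map ?X euclideanreal c"
      unfolding A_def CF_def by blast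
    then have "openin ?X {x \<in> topspace ?X. c x \<in> - {0}}"
      by (rule openin_continuous_map_preimage) auto
    then show ?thesis
      using c(2) by simp
  qed (use U in simp)
  then have op: "\<And>W. W \<in> insert U (?coz ` A) \<Longrightarrow> openin ?X W"
    by blast
  have un: "\<Union>(insert U (?coz ` A)) = topspace ?X"
  proof
    show "\<Union>(insert U (?coz ` A)) \<subseteq> topspace ?X"
      using op openin_subset by blast
    show "topspace ?X \<subseteq> \<Union>(insert U (?coz ` A))"
    proof
      fix x assume x: "x \<in> topspace ?X"
      show "x \<in> \<Union>(insert U (?coz ` A))"
      proof (cases "x \<in> F")
        case True
        then show ?thesis using \<open>F \<subseteq> U\<close> by blast
      next
        case False
        then obtain c where "c \<in> A" "c x \<noteq> 0" using point x by blast
        then have "x \<in> ?coz c" "?coz c \<in> ?coz ` A" using x by blast+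
        then show ?thesis by blast
      qed
    qed
  qed
  have "\<exists>\<V>. countable \<V> \<and> \<V> \<subseteq> insert U (?coz ` A) \<and> \<Union>\<V> = topspace ?X"
    by (rule Lindelof_spaceD[OF assms(2) op un])
  then obtain \<V> where \<V>: "countable \<V>" "\<V> \<subseteq> insert U (?coz ` A)" "\<Union>\<V> = topspace ?X"
    by (elim exE conjE)
  have "countable (\<V> - {U})" "\<V> - {U} \<subseteq> ?coz ` A"
    using \<V>(1,2) by auto
  then have "\<exists>C. countable C \<and> C \<subseteq> A \<and> \<V> - {U} = ?coz ` C"
    by (intro iffD1[OF countable_subset_image] conjI)
  then obtain C where C: "countable C" "C \<subseteq> A" "\<V> - {U} = ?coz ` C"
    by (elim exE conjE)
  show "\<exists>Z. CF_zero_set ?X Z \<and> F \<subseteq> Z \<and> Z \<subseteq> U"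
  proof (intro exI conjI)
    show "CF_zero_set ?X {x \<in> topspace ?X. \<forall>c\<in>C. c x = 0}"
      using C(1,2) unfolding CF_zero_set_def A_def by (intro exI[of _ C]) auto
    show "F \<subseteq> {x \<in> topspace ?X. \<forall>c\<in>C. c x = 0}"
      using C(2) closedin_subset[OF F] unfolding A_def by blast
    show "{x \<in> topspace ?X. \<forall>c\<in>C. c x = 0} \<subseteq> U"
    proof
      fix x assume x: "x \<in> {x \<in> topspace ?X. \<forall>c\<in>C. c x = 0}"
      then obtain W where "W \<in> \<V>" "x \<in> W" using \<V>(3) by blast
      show "x \<in> U"
      proof (rule ccontr)
        assume "x \<notin> U"
        then have "W \<in> \<V> - {U}"
          using \<open>W \<in> \<V>\<close> \<open>x \<in> W\<close> by blast
        then have "W \<in> ?coz ` C"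
          by (simp only: C(3))
        then obtain c where "c \<in> C" "W = ?coz c"
          by (rule imageE)
        then show False
          using x \<open>x \<in> W\<close> by blast
      qed
    qed
  qed
qed

text \<open>\<open>\<pi> n\<close> freezes the coordinates from \<open>n\<close> on; it leaves the largest open subset \<open>G n\<close> of \<open>O'\<close>
  depending only on the first \<open>n\<close> coordinates invariant, so composing with it makes the Urysohn
  functions for \<open>G n\<close> finitely determined.\<close>

lemma perfectly_normal_product_closed_CF_zero_set:
  fixes Xs :: "nat \<Rightarrow> 'a topology"
  assumes pn: "perfectly_normal_space (product_topology Xs UNIV)"
    and F: "closedin (product_topology Xs UNIV) F"
  shows "CF_zero_set (product_topology Xs UNIV) F"
proof (cases "topspace (product_topology Xs UNIV) = {}")
  case True
  then show ?thesis
    using closedin_subset[OF F] unfolding CF_zero_set_def by (intro exI[of _ "{}"]) auto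
next
  case False
  let ?P = "product_topology Xs UNIV"
  obtain p where p: "p \<in> topspace ?P"
    using False by blast
  define O' where "O' = topspace ?P - F"
  have O': "openin ?P O'"
    using F by (simp add: O'_def openin_diff del: topspace_product_topology)
  define G where "G = (\<lambda>n::nat. \<Union>{Pi\<^sub>E UNIV V |V. finite {i. V i \<noteq> topspace (Xs i)} \<and>
      (\<forall>i. openin (Xs i) (V i)) \<and> (\<forall>i\<ge>n. V i = topspace (Xs i)) \<and> Pi\<^sub>E UNIV V \<subseteq> O'})"
  define \<pi> where "\<pi> = (\<lambda>n x i. if i < n then x i else p i :: 'a)"
  have G_open: "openin ?P (G n)" for n
    unfolding G_def by (intro openin_Union) (auto simp: openin_PiE_gen)
  have G_sub: "G n \<subseteq> O'" for n
    unfolding G_def by blast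
  \<comment> \<open>A basic box restricts finitely many coordinates, so it belongs to the family
    defining \<open>G n\<close> once \<open>n\<close> exceeds them all.\<close>
  have O'_sub: "\<exists>n. x \<in> G n" if "x \<in> O'" for x
  proof -
    obtain V where V: "finite {i. V i \<noteq> topspace (Xs i)}" "\<And>i. openin (Xs i) (V i)"
      "x \<in> Pi\<^sub>E UNIV V" "Pi\<^sub>E UNIV V \<subseteq> O'"
      using openin_product_topology_box[OF O' \<open>x \<in> O'\<close>] by blast
    obtain n where "\<forall>i\<in>{i. V i \<noteq> topspace (Xs i)}. i < n"
      using V(1) finite_nat_set_iff_bounded by blast
    then have "\<forall>i\<ge>n. V i = topspace (Xs i)"
      by (meson linorder_not_le mem_Collect_eq)
    then have "x \<in> G n"
      unfolding G_def using V by blast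
    then show ?thesis ..
  qed
  have \<pi>_cont: "continuous_map ?P ?P (\<pi> n)" for n
    unfolding continuous_map_componentwise_UNIV
  proof
    fix k
    show "continuous_map ?P (Xs k) (\<lambda>x. \<pi> n x k)"
      using p by (cases "k < n") (auto simp: \<pi>_def intro: continuous_map_product_projection)
  qed
  have \<pi>_G: "\<pi> n x \<in> G n \<longleftrightarrow> x \<in> G n" if x: "x \<in> topspace ?P" for n x
  proof -
    \<comment> \<open>From index \<open>n\<close> on, \<open>V i\<close> is the whole factor and
      contains both \<open>x i\<close> and \<open>p i\<close>; below \<open>n\<close> the map
      changes nothing.\<close>
    have "\<pi> n x \<in> Pi\<^sub>E UNIV V \<longleftrightarrow> x \<in> Pi\<^sub>E UNIV V" if "\<forall>i\<ge>n. V i = topspace (Xs i)" for V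
    proof -
      have "\<pi> n x i \<in> V i \<longleftrightarrow> x i \<in> V i" for i
        using that p x by (cases "i < n") (auto simp: \<pi>_def)
      then show ?thesis by (simp add: PiE_UNIV_domain Pi_iff)
    qed
    then show ?thesis unfolding G_def by blast
  qed
  have "CF_zero_set ?P (topspace ?P - G n)" for n
  proof -
    have "closedin ?P (topspace ?P - G n)"
      using G_open by blast
    \<comment> \<open>Passing to complements, \<open>G n\<close> is a countable union of closed sets
      \<open>K m\<close>. Urysohn functions \<open>h m\<close>, equal to 0 off \<open>G n\<close>
      and to 1 on \<open>K m\<close>, then exhibit \<open>G n\<close> as the set where some
      \<open>h m\<close> is nonzero.\<close>
    then have "gdelta_in ?P (topspace ?P - G n)"
      using pn unfolding perfectly_normal_space_def by blast
    then have "fsigma_in ?P (G n)"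
      using fsigma_in_gdelta_in openin_subset[OF G_open] by blast
    then obtain K where K: "\<And>m::nat. closedin ?P (K m)" "(\<Union>m. K m) = G n"
      unfolding fsigma_in_ascending by blast
    have "\<exists>h. continuous_map ?P euclideanreal h \<and> h ` (topspace ?P - G n) \<subseteq> {0} \<and> h ` K m \<subseteq> {1}" for m
    proof -
      have "disjnt (topspace ?P - G n) (K m)"
        using K(2) by (auto simp: disjnt_def)
      then show ?thesis
        using pn \<open>closedin ?P (topspace ?P - G n)\<close> K(1)
        unfolding perfectly_normal_space_def by (metis Urysohn_lemma_alt)
    qed
    then obtain h where h: "\<And>m. continuous_map ?P euclideanreal (h m)"
      "\<And>m. h m ` (topspace ?P - G n) \<subseteq> {0}" "\<And>m. h m ` K m \<subseteq> {1}"
      by metis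
    have \<pi>_in: "\<pi> n x \<in> topspace ?P" if "x \<in> topspace ?P" for x
      using continuous_map_image_subset_topspace[OF \<pi>_cont] that by blast
    have "(\<lambda>x. h m (\<pi> n x)) \<in> CF ?P euclideanreal" for m
    proof -
      have "continuous_map ?P euclideanreal (\<lambda>x. h m (\<pi> n x))"
        using continuous_map_compose[OF \<pi>_cont h(1)] by (simp add: o_def)
      moreover have "\<pi> n x = \<pi> n y" if "\<forall>i<n. x i = y i" for x y
        using that by (auto simp: \<pi>_def)
      then have "finitely_determined_on (topspace ?P) (\<lambda>x. h m (\<pi> n x))"
        unfolding finitely_determined_on_def by (metis (no_types))
      ultimately show ?thesis
        by (simp add: CF_def)
    qed
    moreover have "x \<in> G n \<longleftrightarrow> (\<exists>m. h m (\<pi> n x) \<noteq> 0)" if x: "x \<in> topspace ?P" for x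
    proof
      assume "x \<in> G n"
      then have "\<pi> n x \<in> G n"
        using \<pi>_G x by blast
      then obtain m where "\<pi> n x \<in> K m"
        using K(2) by blast
      then have "h m (\<pi> n x) = 1"
        using h(3) by blast
      then show "\<exists>m. h m (\<pi> n x) \<noteq> 0"
        by (intro exI[of _ m]) simp
    next
      assume "\<exists>m. h m (\<pi> n x) \<noteq> 0"
      then show "x \<in> G n"
        using h(2) \<pi>_in[OF x] \<pi>_G[OF x] by blast
    qed
    ultimately show ?thesis
      unfolding CF_zero_set_def by (intro exI[of _ "range (\<lambda>m x. h m (\<pi> n x))"]) auto
  qed
  then have "CF_zero_set ?P (\<Inter>n. topspace ?P - G n)"
    by (rule CF_zero_set_INT)
  also have "(\<Inter>n. topspace ?P - G n) = F"
  proof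
    show "(\<Inter>n. topspace ?P - G n) \<subseteq> F"
      using O'_sub unfolding O'_def by fast
    show "F \<subseteq> (\<Inter>n. topspace ?P - G n)"
    proof (intro INT_greatest subsetI)
      fix n x assume "x \<in> F"
      then show "x \<in> topspace ?P - G n"
        using closedin_subset[OF F] G_sub[of n] unfolding O'_def by blast
    qed
  qed
  finally show ?thesis .
qed

lemma CF_zero_set_subtopology:
  assumes "CF_zero_set P Z"
  shows "CF_zero_set (subtopology P S) (Z \<inter> S)"
proof -
  obtain C where "countable C" "C \<subseteq> CF P euclideanreal" "Z = {x \<in> topspace P. \<forall>c\<in>C. c x = 0}"
    using assms unfolding CF_zero_set_def by blast
  then show ?thesis
    unfolding CF_zero_set_def by (intro exI[of _ C]) (auto intro: CF_subtopology)
qed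

text \<open>Freezing coordinates may lead out of \<open>S\<close>, so closed sets are first
  represented as zero sets in the whole product and then traced on the subspace. The separating set
  is \<open>F\<close> itself.\<close>

lemma CF_zero_separating_perfectly_normal:
  assumes "perfectly_normal_space (product_topology Xs UNIV)"
  shows "CF_zero_separating (subtopology (product_topology Xs UNIV) S)"
  unfolding CF_zero_separating_def
proof (intro allI impI)
  let ?P = "product_topology Xs UNIV"
  fix F U assume "closedin (subtopology ?P S) F" "F \<subseteq> U"
  then obtain T where "closedin ?P T" "F = T \<inter> S"
    unfolding closedin_subtopology by blast
  then have "CF_zero_set (subtopology ?P S) F"
    by (simp only: CF_zero_set_subtopology[OF perfectly_normal_product_closed_CF_zero_set[OF assms]])
  with \<open>F \<subseteq> U\<close> show "\<exists>Z. CF_zero_set (subtopology ?P S) Z \<and> F \<subseteq> Z \<and> Z \<subseteq> U"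
    by blast
qed

theorem theorem8:
  fixes Xs :: "nat \<Rightarrow> 'a topology"
    and S :: "(nat \<Rightarrow> 'a) set"
    and Y :: "'b metric"
    and f :: "(nat \<Rightarrow> 'a) \<Rightarrow> 'b"
  defines "P \<equiv> product_topology Xs UNIV"
  defines "X \<equiv> subtopology P S"
  assumes "\<And>n. completely_regular_space (Xs n)"
    and "S \<subseteq> topspace P"
    and "perfectly_normal_space P \<or> Lindelof_space X"
    and "path_connected_space (mtopology_of Y)"
    and "separable_space (mtopology_of Y)"
    and "R_space Y"
    and "f \<in> Lebesgue_one X (mtopology_of Y)"
  shows "\<exists>g. (\<forall>k::nat. g k \<in> CF X (mtopology_of Y)) \<and>
             (\<forall>x\<in>S. limitin (mtopology_of Y) (\<lambda>k. g k x) (f x) sequentially)"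
proof (cases "mspace Y = {}")
  \<comment> \<open>The approximation enumerates a nonempty dense set, so an empty \<open>Y\<close>
    is set apart; it forces \<open>X\<close> to be empty.\<close>
  case True
  then have "topspace X = {}"
    using assms(9) by (auto simp: Lebesgue_one_def simp del: null_topspace_iff_trivial)
  moreover from this have "S = {}"
    using assms(4) by (auto simp: X_def)
  ultimately show ?thesis
    by (simp add: CF_def finitely_determined_on_def continuous_map_def)
next
  case False
  have "CF_zero_separating X"
    using assms(3,5) CF_zero_separating_perfectly_normal CF_zero_separating_Lindelof
    unfolding X_def P_def by blast
  moreover have "topspace X = S"
    using assms(4) by (auto simp: X_def)
  ultimately show ?thesis
    using Lebesgue_one_limit_of_CF[of X f Y] assms(6-9) False by simp
qed

end
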